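(* Let $f, g \in \mathcal{U}$ satisfy $\frac{f(z)+g(z)}{z} \neq 0$ for all $z \in \mathbb{D}$. Then the function $F$ given by $$F(z) = \frac{2 f(z) g(z)}{f(z)+g(z)}, \quad z \in \mathbb{D},$$ also belongs to the class $\mathcal{U}$.
   Context: $\mathbb{D} = \{z \in \mathbb{C} : |z| < 1\}$ is the open unit disk. $\mathcal{A}$ is the class of analytic functions $f$ on $\mathbb{D}$ normalized by $f(0) = f'(0) - 1 = 0$, i.e. $f(z) = z + a_2 z^2 + a_3 z^3 + \cdots$. The class $\mathcal{U}$ consists of all $f \in \mathcal{A}$ satisfying $$\left| f'(z) \left( \frac{z}{f(z)} \right)^2 - 1 \right| \le 1, \quad z \in \mathbb{D}.$$ Here it is understood that $f(z) \ne 0$ for $0 < |z| < 1$, and that $z/f(z)$ is the analytic function on $\mathbb{D}$ with value $1$ at $z = 0$. Expressions such as $(f(z)+g(z))/z$ and $F(z)$ are taken at $z=0$ by their analytic extension (so $(f(z)+g(z))/z$ has value $2$ and $F$ has value $0$ at $z=0$). *)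

theory Defs
  imports "HOL-Complex_Analysis.Complex_Analysis"
begin

abbreviation unit_disk :: "complex set" where
  "unit_disk \<equiv> ball 0 1"

(* Functions are total on the complex plane; only their values on the unit disk matter below. *)
definition class_A :: "(complex \<Rightarrow> complex) set" where
  "class_A = {f. f holomorphic_on unit_disk \<and> f 0 = 0 \<and> deriv f 0 = 1}"

(* The analytic extension of z / f z across the removable singularity at 0, for f in class_A.
   The explicit value is needed because 0 / 0 = 0 in HOL. *)
definition z_over :: "(complex \<Rightarrow> complex) \<Rightarrow> complex \<Rightarrow> complex" where
  "z_over f z = (if z = 0 then 1 else z / f z)"

definition class_U :: "(complex \<Rightarrow> complex) set" where
  "class_U = {f \<in> class_A.
     (\<forall>z\<in>unit_disk - {0}. f z \<noteq> 0) \<and>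
     (\<forall>z\<in>unit_disk. norm (deriv f z * (z_over f z)\<^sup>2 - 1) \<le> 1)}"

(* The analytic extensions of (f z + g z) / z and of 2 * f z * g z / (f z + g z) across 0,
   for f and g in class_A. *)
definition sum_over_z :: "(complex \<Rightarrow> complex) \<Rightarrow> (complex \<Rightarrow> complex) \<Rightarrow> complex \<Rightarrow> complex" where
  "sum_over_z f g z = (if z = 0 then 2 else (f z + g z) / z)"

definition harmonic_mean ::
  "(complex \<Rightarrow> complex) \<Rightarrow> (complex \<Rightarrow> complex) \<Rightarrow> complex \<Rightarrow> complex" where
  "harmonic_mean f g z = (if z = 0 then 0 else 2 * f z * g z / (f z + g z))"

end

theory Submission imports Defs
begin

text \<open>The harmonic mean is the operation that averages reciprocals: where \<open>F = 2 f g / (f + g)\<close>,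
  \<open>z / F = (z / f + z / g) / 2\<close>. The functional \<open>f \<mapsto> f' (z / f)\<^sup>2\<close> that defines the class
  depends on \<open>p = z / f\<close> only and is linear in it: it equals \<open>p - z p'\<close>. So its value at \<open>F\<close> is the
  midpoint of its values at \<open>f\<close> and \<open>g\<close> (\<open>U_functional_harmonic_mean\<close>), and the closed disk of
  radius 1 about 1, where those values lie, is convex.

  The remaining point is that \<open>F\<close> is analytic and normalized although \<open>f + g\<close> vanishes at the
  origin. Dividing out the common zero, \<open>f = z h\<close> and \<open>g = z k\<close>, gives \<open>F = z (2 h k / (h + k))\<close>,
  whose denominator \<open>h + k\<close> is the function assumed to have no zero
  (\<open>harmonic_mean_in_class_A\<close>).\<close>

lemma holomorphic_quotient_by_z:
  assumes "f \<in> class_A"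
  shows "(\<lambda>z. if z = 0 then 1 else f z / z) holomorphic_on unit_disk"
proof -
  have "f holomorphic_on unit_disk" "f 0 = 0" "deriv f 0 = 1"
    using assms by (auto simp: class_A_def)
  then show ?thesis
    using pole_lemma[of f unit_disk 0] by (simp cong: if_cong)
qed

lemma harmonic_mean_in_class_A:
  assumes f: "f \<in> class_A" and g: "g \<in> class_A"
    and nz: "\<forall>z\<in>unit_disk. sum_over_z f g z \<noteq> 0"
    and F: "\<forall>z\<in>unit_disk. F z = harmonic_mean f g z"
  shows "F \<in> class_A"
proof -
  define h where "h = (\<lambda>z. if z = 0 then 1 else f z / z)"
  define k where "k = (\<lambda>z. if z = 0 then 1 else g z / z)"
  define q where "q = (\<lambda>z. 2 * h z * k z / (h z + k z))"
  have hol: "h holomorphic_on unit_disk" "k holomorphic_on unit_disk"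
    unfolding h_def k_def using f g by (auto intro: holomorphic_quotient_by_z)
  have hk: "h z + k z \<noteq> 0" if "z \<in> unit_disk" for z
    using nz[rule_format, OF that]
    by (simp add: h_def k_def sum_over_z_def add_divide_distrib split: if_splits)
  have q: "q holomorphic_on unit_disk"
    unfolding q_def using hol hk by (auto intro!: holomorphic_intros)
  have Fq: "F z = z * q z" if "z \<in> unit_disk" for z
  proof (cases "z = 0")
    case False
    then show ?thesis
      using False F that
      by (simp add: harmonic_mean_def q_def h_def k_def flip: add_divide_distrib)
  qed (use F that in \<open>simp add: harmonic_mean_def\<close>)
  have "(\<lambda>z. z * q z) holomorphic_on unit_disk"
    using q by (intro holomorphic_intros)
  then have "F holomorphic_on unit_disk"
    using Fq by (metis (no_types, lifting) holomorphic_transform)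
  moreover have "deriv F 0 = 1"
  proof -
    have "(q has_field_derivative deriv q 0) (at 0)"
      using q by (auto intro: holomorphic_derivI)
    then have "((\<lambda>z. z * q z) has_field_derivative q 0) (at 0)"
      by (auto intro!: derivative_eq_intros)
    then have "(F has_field_derivative q 0) (at 0)"
      by (rule has_field_derivative_transform_within_open[where S = unit_disk]) (auto simp: Fq)
    then show ?thesis
      by (simp add: DERIV_imp_deriv q_def h_def k_def)
  qed
  ultimately show ?thesis
    using Fq by (simp add: class_A_def)
qed

text \<open>The midpoint property that comes from linearity in \<open>z / f\<close>. The quotient rule gives it
  without differentiating \<open>z / f\<close>: the numerator of \<open>F'\<close> collapses to
  \<open>2 (f' g\<^sup>2 + g' f\<^sup>2)\<close>.\<close>

lemma U_functional_harmonic_mean: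
  assumes S: "open S" "z \<in> S" "0 \<notin> S"
    and hol: "f holomorphic_on S" "g holomorphic_on S"
    and nz: "f z \<noteq> 0" "g z \<noteq> 0" "f z + g z \<noteq> 0"
    and F: "\<forall>w\<in>S. F w = harmonic_mean f g w"
  shows "deriv F z * (z_over F z)\<^sup>2 =
    (deriv f z * (z_over f z)\<^sup>2 + deriv g z * (z_over g z)\<^sup>2) / 2"
proof -
  have z: "z \<noteq> 0"
    using S by auto
  have F_eq: "F w = 2 * f w * g w / (f w + g w)" if "w \<in> S" for w
    using F S that by (auto simp: harmonic_mean_def)
  have "(f has_field_derivative deriv f z) (at z)" "(g has_field_derivative deriv g z) (at z)"
    using hol S by (auto intro: holomorphic_derivI)
  then have "((\<lambda>w. 2 * f w * g w / (f w + g w)) has_field_derivative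
      2 * (deriv f z * (g z)\<^sup>2 + deriv g z * (f z)\<^sup>2) / (f z + g z)\<^sup>2) (at z)"
    using nz by (auto intro!: derivative_eq_intros simp: power2_eq_square algebra_simps)
  then have "(F has_field_derivative
      2 * (deriv f z * (g z)\<^sup>2 + deriv g z * (f z)\<^sup>2) / (f z + g z)\<^sup>2) (at z)"
    by (rule has_field_derivative_transform_within_open[where S = S]) (use S F_eq in auto)
  then have dF: "deriv F z = 2 * (deriv f z * (g z)\<^sup>2 + deriv g z * (f z)\<^sup>2) / (f z + g z)\<^sup>2"
    by (rule DERIV_imp_deriv)
  have zF: "z_over F z = z * (f z + g z) / (2 * f z * g z)"
    using z nz S F_eq by (simp add: z_over_def)
  have "2 * (a * v\<^sup>2 + b * u\<^sup>2) / s\<^sup>2 * (z * s / (2 * u * v))\<^sup>2 =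
      (a * (z / u)\<^sup>2 + b * (z / v)\<^sup>2) / 2"
    if "u \<noteq> 0" "v \<noteq> 0" "s \<noteq> 0" for a b u v s :: complex
    using that by (simp add: divide_simps) (simp add: power2_eq_square algebra_simps)
  from this[OF nz] show ?thesis
    using z unfolding dF zF by (simp add: z_over_def)
qed

theorem theorem1:
  fixes f g F :: "complex \<Rightarrow> complex"
  assumes "f \<in> class_U" and "g \<in> class_U"
    and "\<forall>z\<in>unit_disk. sum_over_z f g z \<noteq> 0"
    and "\<forall>z\<in>unit_disk. F z = harmonic_mean f g z"
  shows "F \<in> class_U"
proof -
  have fA: "f \<in> class_A" and gA: "g \<in> class_A"
    using assms(1,2) by (auto simp: class_U_def)
  have FA: "F \<in> class_A"
    using harmonic_mean_in_class_A[OF fA gA assms(3,4)] .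
  have nz: "f z \<noteq> 0" "g z \<noteq> 0" "f z + g z \<noteq> 0" if "z \<in> unit_disk - {0}" for z
    using assms(1,2) assms(3)[rule_format, of z] that
    by (simp_all add: class_U_def sum_over_z_def)
  have F_nz: "F z \<noteq> 0" if "z \<in> unit_disk - {0}" for z
    using nz[OF that] assms(4) that by (simp add: harmonic_mean_def)
  have "norm (deriv F z * (z_over F z)\<^sup>2 - 1) \<le> 1" if z: "z \<in> unit_disk" for z
  proof (cases "z = 0")
    case True
    then show ?thesis
      using FA by (simp add: class_A_def z_over_def)
  next
    case False
    define a where "a = deriv f z * (z_over f z)\<^sup>2"
    define b where "b = deriv g z * (z_over g z)\<^sup>2"
    have "f holomorphic_on unit_disk - {0}" "g holomorphic_on unit_disk - {0}"
      using fA gA by (auto simp: class_A_def intro: holomorphic_on_subset)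
    then have mid: "deriv F z * (z_over F z)\<^sup>2 = (a + b) / 2"
      unfolding a_def b_def
      using False z nz[of z] assms(4)
      by (intro U_functional_harmonic_mean[where S = "unit_disk - {0}"]) auto
    have "a \<in> cball 1 1" "b \<in> cball 1 1"
      using assms(1,2) z by (auto simp: class_U_def a_def b_def dist_norm norm_minus_commute)
    then have "(1/2) *\<^sub>R a + (1/2) *\<^sub>R b \<in> cball 1 1"
      by (intro convexD[OF convex_cball]) auto
    then show ?thesis
      unfolding mid
      by (simp add: dist_norm norm_minus_commute scaleR_conv_of_real add_divide_distrib)
  qed
  with FA F_nz show ?thesis
    by (simp add: class_U_def)
qed

end
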